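(* Let $n\ge 1$ and let $S\subseteq \mathbb{S}^{n-1}$ be a Borel subset of the unit hyper-sphere in $\mathbb{R}^n$ such that $\dim_B S\equiv \delta\geq 0$. For every $\alpha>0$, the $\alpha$-regular fractal nest of centre type $\mathcal{F}_\alpha S=\bigcup_{k=1}^\infty (k^{-\alpha})S$ satisfies: (i) if $\alpha\delta<1$, then $\dim_B \mathcal{F}_\alpha S\equiv \frac{\delta+1}{\alpha+1}$; (ii) if $\alpha\delta=1$, then $\dim_B \mathcal{F}_\alpha S= \delta$; (iii) if $\alpha\delta>1$, then $\dim_B \mathcal{F}_\alpha S\equiv \delta$.
   Context: For $S\subseteq\mathbb{R}^n$ and $x\ge 0$, $(x)S=\{xs : s\in S\}$ is the scaling of $S$ by $x$. For $\epsilon>0$, $(S)_\epsilon=\{x\in\mathbb{R}^n : d(x,S)\le\epsilon\}$ (Euclidean distance), and $\lambda$ is Lebesgue measure on $\mathbb{R}^n$. For a bounded Borel set $S\subseteq\mathbb{R}^n$, $N_\epsilon(S)$ is the number of cubes of the $\epsilon$-mesh of $\mathbb{R}^n$ (the partition of $\mathbb{R}^n$ into $n$-cubes of side $\epsilon$, disjoint except possibly at the border) that intersect $S$. The upper and lower box counting dimensions are $\overline{\dim}_B S=\inf\{\delta\in\mathbb{R} : \epsilon^\delta N_\epsilon(S)\to 0 \text{ as }\epsilon\to0\}$ and $\underline{\dim}_B S=\sup\{\delta\in\mathbb{R} : \epsilon^\delta N_\epsilon(S)\to +\infty\text{ as }\epsilon\to0\}$. Write $\dim_B S=d$ if $\overline{\dim}_B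 S=\underline{\dim}_B S=d$. Let $\gamma_x=\frac{\pi^{x/2}}{\Gamma(x/2+1)}$ and $A^{n,d}_\epsilon(S)=\frac{\lambda\left((S)_\epsilon\right)}{\gamma_{n-d}\,\epsilon^{n-d}}$. For $S$ with $\dim_B S=d$, the normalised upper and lower Minkowski contents are $\mathcal{M}^*_d(S)=\limsup_{\epsilon\to0}A^{n,d}_\epsilon(S)$ and $\mathcal{M}_{*d}(S)=\liminf_{\epsilon\to0}A^{n,d}_\epsilon(S)$. The notation $\dim_B S\equiv d$ means that $\dim_B S=d$ and $S$ is Minkowski-non-degenerate, i.e. $\mathcal{M}^*_d(S)<+\infty$ and $\mathcal{M}_{*d}(S)>0$. *)

theory Defs
  imports "HOL-Analysis.Analysis"
begin

definition scaling :: "real \<Rightarrow> (real ^ 'n) set \<Rightarrow> (real ^ 'n) set" where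
  "scaling x S = (\<lambda>s. x *\<^sub>R s) ` S"

text \<open>
  Since \<^term>\<open>infdist x {} = 0\<close> in the library, the empty set is treated separately:
  mathematically its distance to any point is infinite.
\<close>

definition nbhd :: "(real ^ 'n) set \<Rightarrow> real \<Rightarrow> (real ^ 'n) set" where
  "nbhd S \<epsilon> = {x. S \<noteq> {} \<and> infdist x S \<le> \<epsilon>}"

definition mesh :: "real \<Rightarrow> (real ^ 'n) set set" where
  "mesh \<epsilon> = range (\<lambda>m :: int ^ 'n.
     cbox (\<chi> i. \<epsilon> * real_of_int (m $ i)) (\<chi> i. \<epsilon> * (real_of_int (m $ i) + 1)))"

text \<open>
  For bounded \<open>S\<close> and \<open>\<epsilon> > 0\<close> only finitely many cubes meet \<open>S\<close>.
  For unbounded \<open>S\<close> the value (and everything below) carries no meaning.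
\<close>

definition box_count :: "real \<Rightarrow> (real ^ 'n) set \<Rightarrow> nat" where
  "box_count \<epsilon> S = card {Q \<in> mesh \<epsilon>. Q \<inter> S \<noteq> {}}"

text \<open>
  The infimum and supremum are taken in the extended reals, so that both dimensions of the
  empty set are \<open>-\<infinity>\<close> rather than an unspecified real number.
\<close>

definition upper_box_dim :: "(real ^ 'n) set \<Rightarrow> ereal" where
  "upper_box_dim S = Inf (ereal `
     {\<delta>. ((\<lambda>\<epsilon>. \<epsilon> powr \<delta> * real (box_count \<epsilon> S)) \<longlongrightarrow> 0) (at_right 0)})"

definition lower_box_dim :: "(real ^ 'n) set \<Rightarrow> ereal" where
  "lower_box_dim S = Sup (ereal `
     {\<delta>. filterlim (\<lambda>\<epsilon>. \<epsilon> powr \<delta> * real (box_count \<epsilon> S)) at_top (at_right 0)})"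

definition has_box_dim :: "(real ^ 'n) set \<Rightarrow> real \<Rightarrow> bool" where
  "has_box_dim S d \<longleftrightarrow> upper_box_dim S = ereal d \<and> lower_box_dim S = ereal d"

text \<open>For a natural number \<open>x\<close>, this is the volume of the unit ball in dimension \<open>x\<close>.\<close>

definition ball_const :: "real \<Rightarrow> real" where
  "ball_const x = pi powr (x / 2) / Gamma (x / 2 + 1)"

definition mink_ratio :: "real \<Rightarrow> real \<Rightarrow> (real ^ 'n) set \<Rightarrow> real" where
  "mink_ratio d \<epsilon> S =
     measure lebesgue (nbhd S \<epsilon>) /
       (ball_const (real CARD('n) - d) * \<epsilon> powr (real CARD('n) - d))"

definition upper_mink_content :: "real \<Rightarrow> (real ^ 'n) set \<Rightarrow> ereal" where
  "upper_mink_content d S = Limsup (at_right 0) (\<lambda>\<epsilon>. ereal (mink_ratio d \<epsilon> S))"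

definition lower_mink_content :: "real \<Rightarrow> (real ^ 'n) set \<Rightarrow> ereal" where
  "lower_mink_content d S = Liminf (at_right 0) (\<lambda>\<epsilon>. ereal (mink_ratio d \<epsilon> S))"

definition has_nondegenerate_box_dim :: "(real ^ 'n) set \<Rightarrow> real \<Rightarrow> bool" where
  "has_nondegenerate_box_dim S d \<longleftrightarrow>
     has_box_dim S d \<and> upper_mink_content d S < \<infinity> \<and> lower_mink_content d S > 0"

definition fractal_nest :: "real \<Rightarrow> (real ^ 'n) set \<Rightarrow> (real ^ 'n) set" where
  "fractal_nest \<alpha> S = (\<Union>k\<in>{1::nat..}. scaling (real k powr (- \<alpha>)) S)"

end

theory Submission
  imports Defs
begin

text \<open>
  Everything is read off the parallel volume \<open>V S r = \<lambda> ((S)\<^sub>r)\<close>, which is comparable to \<open>r powr (n - \<delta>)\<close>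
  for the given \<open>S\<close>. Scaling turns this into \<open>\<epsilon> powr (n - \<delta>) * k powr - (\<alpha> * \<delta>)\<close> for the layer of index \<open>k\<close>.
  Let \<open>M = \<epsilon> powr (- 1 / (\<alpha> + 1))\<close>, the index at which the gap between layers, of order \<open>k powr (- \<alpha> - 1)\<close>,
  reaches the scale \<open>\<epsilon>\<close>. The layers with \<open>k \<le> M\<close> are handled one by one; all later ones lie within
  \<open>\<epsilon>\<close> of the about \<open>M\<close> copies \<open>(j \<epsilon>) S\<close>, whose total volume is at most of order
  \<open>\<epsilon> powr (n - \<delta>) * M powr (1 - \<alpha> * \<delta>)\<close>. So the volume of the nest is bounded by
  \<open>\<epsilon> powr (n - \<delta>)\<close> times \<open>(\<Sum>k\<le>M. k powr - (\<alpha> * \<delta>)) + M powr (1 - \<alpha> * \<delta>)\<close>, and the sum grows like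
  a power of \<open>M\<close>, logarithmically, or not at all according to the sign of \<open>1 - \<alpha> * \<delta>\<close>. From below, the
  first layer suffices if \<open>\<alpha> * \<delta> \<ge> 1\<close>; otherwise the layers with \<open>k \<le> b * M\<close>, \<open>b\<close> small, have
  pairwise disjoint neighbourhoods and their volumes add up.
\<close>

section \<open>Parallel sets and box counts\<close>

text \<open>\<open>S\<close> need not be closed, so the infimum behind \<open>infdist\<close> may
  not be attained; hence a strict bound for every \<open>e > r\<close>. For empty \<open>S\<close>
  the existential fails, which agrees with the convention in \<open>nbhd\<close>.\<close>

lemma nbhd_eq: "nbhd S r = {x. \<forall>e>r. \<exists>s\<in>S. dist x s < e}"
proof (cases "S = {}")
  case True
  then show ?thesis
    by (auto simp: nbhd_def intro: gt_ex)
next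
  case False
  have "infdist x S \<le> r \<longleftrightarrow> (\<forall>e>r. \<exists>s\<in>S. dist x s < e)" for x
  proof -
    have "infdist x S < e \<longleftrightarrow> (\<exists>s\<in>S. dist x s < e)" for e
      unfolding infdist_notempty[OF False]
      by (rule cINF_less_iff[OF False]) (auto intro: bdd_belowI2[where m = 0])
    moreover have "infdist x S \<le> r \<longleftrightarrow> (\<forall>e>r. infdist x S < e)"
      by (meson dense_ge le_less_trans less_imp_le)
    ultimately show ?thesis
      by simp
  qed
  with False show ?thesis
    by (simp add: nbhd_def)
qed

lemma nbhd_empty [simp]: "nbhd {} r = {}"
  by (simp add: nbhd_def)

lemma mem_nbhdI: "s \<in> S \<Longrightarrow> dist x s \<le> r \<Longrightarrow> x \<in> nbhd S r"
  unfolding nbhd_eq mem_Collect_eq by (metis le_less_trans)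

lemma mem_nbhdE:
  assumes "x \<in> nbhd S r" "r < e"
  obtains s where "s \<in> S" "dist x s < e"
  using assms unfolding nbhd_eq by blast

lemma nbhd_mono: "S \<subseteq> T \<Longrightarrow> r \<le> r' \<Longrightarrow> nbhd S r \<subseteq> nbhd T r'"
  unfolding nbhd_eq by (rule Collect_mono) (meson le_less_trans subsetD)

text \<open>The summand \<open>+ 0\<close> gives the map the affine shape that
  \<open>measure_lebesgue_affine\<close> expects.\<close>

lemma nbhd_scaling:
  assumes "t > 0"
  shows "nbhd (scaling t S) r = (\<lambda>x. t *\<^sub>R x + 0) ` nbhd S (r / t)"
proof -
  have *: "t *\<^sub>R x \<in> nbhd (scaling t S) r \<longleftrightarrow> x \<in> nbhd S (r / t)" for x
  proof -
    have "t *\<^sub>R x \<in> nbhd (scaling t S) r \<longleftrightarrow> (\<forall>e>r. \<exists>s\<in>S. t * dist x s < e)"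
      using assms by (simp add: nbhd_eq scaling_def dist_norm flip: scaleR_diff_right)
    also have "\<dots> \<longleftrightarrow> (\<forall>e>r. \<exists>s\<in>S. dist x s < e / t)"
      using assms by (simp add: field_simps)
    also have "\<dots> \<longleftrightarrow> (\<forall>e>r / t. \<exists>s\<in>S. dist x s < e)"
    proof safe
      fix e assume "\<forall>e>r. \<exists>s\<in>S. dist x s < e / t" "e > r / t"
      then show "\<exists>s\<in>S. dist x s < e"
        using assms by (auto simp: field_simps dest!: spec[of _ "e * t"])
    qed (use assms in \<open>auto simp: divide_strict_right_mono\<close>)
    finally show ?thesis
      by (simp add: nbhd_eq)
  qed
  show ?thesis
  proof (intro set_eqI iffI)
    fix y assume "y \<in> nbhd (scaling t S) r"
    then show "y \<in> (\<lambda>x. t *\<^sub>R x + 0) ` nbhd S (r / t)"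
      using *[of "(1 / t) *\<^sub>R y"] assms by (auto intro!: image_eqI[where x = "(1 / t) *\<^sub>R y"])
  qed (use * in auto)
qed

lemma bounded_nbhd:
  assumes "bounded S"
  shows "bounded (nbhd S r)"
proof -
  obtain B where B: "\<And>s. s \<in> S \<Longrightarrow> norm s \<le> B"
    using assms unfolding bounded_iff by blast
  have "norm x \<le> B + (r + 1)" if x: "x \<in> nbhd S r" for x
  proof -
    obtain s where "s \<in> S" "dist x s < r + 1"
      using x by (rule mem_nbhdE) auto
    then show ?thesis
      using B[of s] norm_triangle_sub[of x s] by (simp add: dist_norm)
  qed
  then show ?thesis
    unfolding bounded_iff by blast
qed

lemma closed_nbhd: "closed (nbhd S r)"
proof (cases "S = {}")
  case False
  have "closed {x. infdist x S \<le> r}"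
    by (intro closed_Collect_le continuous_intros)
  with False show ?thesis
    by (simp add: nbhd_def)
qed simp

lemma lmeasurable_nbhd: "bounded S \<Longrightarrow> nbhd S r \<in> lmeasurable"
  by (simp add: bounded_nbhd closed_nbhd compact_eq_bounded_closed lmeasurable_compact)

definition nbhd_vol :: "(real ^ 'n) set \<Rightarrow> real \<Rightarrow> real" where
  "nbhd_vol S r = measure lebesgue (nbhd S r)"

lemma nbhd_vol_nonneg [simp]: "nbhd_vol S r \<ge> 0"
  by (simp add: nbhd_vol_def)

lemma nbhd_vol_mono:
  assumes "bounded T" "S \<subseteq> T" "r \<le> r'"
  shows "nbhd_vol S r \<le> nbhd_vol T r'"
  unfolding nbhd_vol_def using assms
  by (metis bounded_subset fmeasurableD lmeasurable_nbhd measure_mono_fmeasurable nbhd_mono)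

lemma nbhd_vol_scaling:
  fixes S :: "(real ^ 'n) set"
  assumes "t > 0"
  shows "nbhd_vol (scaling t S) r = t ^ CARD('n) * nbhd_vol S (r / t)"
  using assms measure_lebesgue_affine[of t 0 "nbhd S (r / t)"]
  by (simp add: nbhd_vol_def nbhd_scaling)

section \<open>Mesh cubes and parallel volumes bound each other\<close>

text \<open>A packing argument: the interiors of the cubes meeting \<open>S\<close> are disjoint,
  have volume \<open>\<epsilon> ^ n\<close>, and lie in one parallel set. It is run on finite
  subfamilies first, since the uniform bound on their size is what proves the whole family
  finite.\<close>

lemma finite_card_mesh_le:
  fixes S :: "(real ^ 'n) set"
  assumes "bounded S" "\<epsilon> > 0"
  shows "finite {Q \<in> mesh \<epsilon>. Q \<inter> S \<noteq> {}}"
    and "real (box_count \<epsilon> S) * \<epsilon> ^ CARD('n) \<le> nbhd_vol S (real CARD('n) * \<epsilon>)"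
proof -
  define V where "V = nbhd_vol S (real CARD('n) * \<epsilon>)"
  define l u :: "int ^ 'n \<Rightarrow> real ^ 'n" where
    "l m = (\<chi> i. \<epsilon> * real_of_int (m $ i))" and "u m = (\<chi> i. \<epsilon> * (real_of_int (m $ i) + 1))" for m
  have mesh: "mesh \<epsilon> = range (\<lambda>m. cbox (l m) (u m))"
    by (simp add: mesh_def l_def u_def)
  have card_le: "real (card T) * \<epsilon> ^ CARD('n) \<le> V"
    if T: "finite T" "T \<subseteq> {Q \<in> mesh \<epsilon>. Q \<inter> S \<noteq> {}}" for T
  proof -
    \<comment> \<open>One index per cube is selected, so that cardinalities and sums over cubes
      become sums over \<open>I\<close>.\<close>
    obtain I where I: "inj_on (\<lambda>m. cbox (l m) (u m)) I" "T = (\<lambda>m. cbox (l m) (u m)) ` I"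
    proof -
      have "T \<subseteq> (\<lambda>m. cbox (l m) (u m)) ` UNIV"
        using T(2) unfolding mesh by blast
      then show thesis
        using that unfolding subset_image_inj by blast
    qed
    have fin: "finite I"
      using I T(1) finite_imageD by blast
    have vol: "measure lebesgue (box (l m) (u m)) = \<epsilon> ^ CARD('n)" for m
    proof -
      have "cbox (l m) (u m) \<noteq> {}"
        using assms by (auto simp: interval_eq_empty_cart l_def u_def not_less)
      then have "measure lebesgue (cbox (l m) (u m)) = \<epsilon> ^ CARD('n)"
        by (simp add: content_cbox_cart) (simp add: l_def u_def algebra_simps)
      then show ?thesis
        by (simp add: measure_lborel_box_eq measure_lborel_cbox_eq)
    qed
    \<comment> \<open>Closed cubes share faces, but a point of an open cube determines its index
      through floors; this gives disjointness below.\<close>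
    have floor: "m $ i = \<lfloor>x $ i / \<epsilon>\<rfloor>" if "x \<in> box (l m) (u m)" for x m i
      using that assms unfolding mem_box_cart l_def u_def
      by (intro floor_unique[symmetric]) (auto simp: field_simps dest!: spec[of _ i])
    have disj: "pairwise (\<lambda>m m'. disjnt (box (l m) (u m)) (box (l m') (u m'))) I"
      unfolding pairwise_def disjnt_iff
      by (metis floor vec_eq_iff)
    have sub: "(\<Union>m\<in>I. box (l m) (u m)) \<subseteq> nbhd S (real CARD('n) * \<epsilon>)"
    proof safe
      fix m x assume m: "m \<in> I" and x: "x \<in> box (l m) (u m)"
      obtain s where s: "s \<in> S" "s \<in> cbox (l m) (u m)"
        using I T(2) m by blast
      \<comment> \<open>Two points of a cube differ by at most \<epsilon> in each of the n
        coordinates; the l1 norm then yields the radius \<open>n * \<epsilon>\<close>.\<close>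
      have "norm (x - s) \<le> (\<Sum>i\<in>UNIV. \<bar>(x - s) $ i\<bar>)"
        by (rule norm_le_l1_cart)
      also have "\<dots> \<le> (\<Sum>i\<in>(UNIV :: 'n set). \<epsilon>)"
      proof (rule sum_mono)
        fix i
        have "l m $ i \<le> x $ i" "x $ i \<le> u m $ i" "l m $ i \<le> s $ i" "s $ i \<le> u m $ i"
          using x s(2) by (auto simp: mem_box_cart less_imp_le)
        moreover have "u m $ i - l m $ i = \<epsilon>"
          by (simp add: u_def l_def algebra_simps)
        ultimately show "\<bar>(x - s) $ i\<bar> \<le> \<epsilon>"
          by simp
      qed
      finally show "x \<in> nbhd S (real CARD('n) * \<epsilon>)"
        using s(1) by (intro mem_nbhdI) (auto simp: dist_norm)
    qed
    have "real (card T) * \<epsilon> ^ CARD('n) = (\<Sum>m\<in>I. measure lebesgue (box (l m) (u m)))"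
      using I by (simp add: vol card_image)
    also have "\<dots> = measure lebesgue (\<Union>m\<in>I. box (l m) (u m))"
      by (rule measure_UNION'[symmetric, OF fin _ disj]) (auto intro: lmeasurable_open)
    also have "\<dots> \<le> V"
      unfolding V_def nbhd_vol_def using assms fin
      by (intro measure_mono_fmeasurable sub lmeasurable_nbhd) auto
    finally show ?thesis .
  qed
  have "card T \<le> nat \<lfloor>V / \<epsilon> ^ CARD('n)\<rfloor>"
    if "T \<subseteq> {Q \<in> mesh \<epsilon>. Q \<inter> S \<noteq> {}}" "finite T" for T
    using card_le[OF that(2,1)] assms by (simp add: le_nat_floor pos_le_divide_eq)
  then show fin: "finite {Q \<in> mesh \<epsilon>. Q \<inter> S \<noteq> {}}"
    using finite_if_finite_subsets_card_bdd by blast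
  show "real (box_count \<epsilon> S) * \<epsilon> ^ CARD('n) \<le> nbhd_vol S (real CARD('n) * \<epsilon>)"
    using card_le[OF fin] by (simp add: box_count_def V_def)
qed

text \<open>A point of the parallel set is less than \<open>2 * \<epsilon>\<close> away from some
  point of \<open>S\<close> (distance \<epsilon> itself may not be attained). It therefore lies in a
  cube meeting \<open>S\<close> after that cube is extended by two sides in each direction, which
  makes the side \<open>5 * \<epsilon>\<close>.\<close>

lemma nbhd_vol_le_box_count:
  fixes S :: "(real ^ 'n) set"
  assumes "bounded S" "\<epsilon> > 0"
  shows "nbhd_vol S \<epsilon> \<le> real (box_count \<epsilon> S) * (5 * \<epsilon>) ^ CARD('n)"
proof -
  define l u l' u' :: "int ^ 'n \<Rightarrow> real ^ 'n" where
    "l m = (\<chi> i. \<epsilon> * real_of_int (m $ i))" and "u m = (\<chi> i. \<epsilon> * (real_of_int (m $ i) + 1))"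
    and "l' m = (\<chi> i. \<epsilon> * (real_of_int (m $ i) - 2))" and "u' m = (\<chi> i. \<epsilon> * (real_of_int (m $ i) + 3))" for m
  have mesh: "mesh \<epsilon> = range (\<lambda>m. cbox (l m) (u m))"
    by (simp add: mesh_def l_def u_def)
  obtain I where I: "inj_on (\<lambda>m. cbox (l m) (u m)) I"
      "{Q \<in> mesh \<epsilon>. Q \<inter> S \<noteq> {}} = (\<lambda>m. cbox (l m) (u m)) ` I"
  proof -
    have "{Q \<in> mesh \<epsilon>. Q \<inter> S \<noteq> {}} \<subseteq> (\<lambda>m. cbox (l m) (u m)) ` UNIV"
      unfolding mesh by blast
    then show thesis
      using that unfolding subset_image_inj by blast
  qed
  have fin: "finite I"
    using finite_imageD finite_card_mesh_le(1)[OF assms] I by metis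
  have vol: "measure lebesgue (cbox (l' m) (u' m)) = (5 * \<epsilon>) ^ CARD('n)" for m
  proof -
    have "cbox (l' m) (u' m) \<noteq> {}"
      using assms by (auto simp: interval_eq_empty_cart l'_def u'_def not_less)
    then show ?thesis
      by (simp add: content_cbox_cart) (simp add: l'_def u'_def algebra_simps)
  qed
  have sub: "nbhd S \<epsilon> \<subseteq> (\<Union>m\<in>I. cbox (l' m) (u' m))"
  proof
    fix x assume "x \<in> nbhd S \<epsilon>"
    then obtain s where s: "s \<in> S" "dist x s < 2 * \<epsilon>"
      by (rule mem_nbhdE[where e = "2 * \<epsilon>"]) (use assms in auto)
    define m where "m = (\<chi> i. \<lfloor>s $ i / \<epsilon>\<rfloor>)"
    have m: "\<epsilon> * real_of_int (m $ i) \<le> s $ i" "s $ i \<le> \<epsilon> * (real_of_int (m $ i) + 1)" for i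
      using assms floor_divide_lower[of \<epsilon> "s $ i"] floor_divide_upper[of \<epsilon> "s $ i"]
      by (auto simp: m_def mult.commute less_imp_le)
    then have "s \<in> cbox (l m) (u m)"
      by (simp add: mem_box_cart l_def u_def)
    with s(1) have "cbox (l m) (u m) \<in> {Q \<in> mesh \<epsilon>. Q \<inter> S \<noteq> {}}"
      unfolding mesh by blast
    \<comment> \<open>The cube found through floors may be represented in \<open>I\<close> by
      another index, so the argument continues with \<open>m'\<close>.\<close>
    then obtain m' where m': "m' \<in> I" "cbox (l m) (u m) = cbox (l m') (u m')"
      unfolding I(2) by blast
    have sm: "s \<in> cbox (l m') (u m')"
      using m' \<open>s \<in> cbox (l m) (u m)\<close> by simp
    have "x \<in> cbox (l' m') (u' m')"
      unfolding mem_box_cart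
    proof
      fix i
      have "\<bar>x $ i - s $ i\<bar> < 2 * \<epsilon>"
        using component_le_norm_cart[of "x - s" i] s(2) by (simp add: dist_norm)
      moreover have "\<epsilon> * real_of_int (m' $ i) \<le> s $ i" "s $ i \<le> \<epsilon> * (real_of_int (m' $ i) + 1)"
        using sm by (auto simp: mem_box_cart l_def u_def)
      ultimately show "l' m' $ i \<le> x $ i \<and> x $ i \<le> u' m' $ i"
        by (simp add: l'_def u'_def algebra_simps abs_less_iff)
    qed
    then show "x \<in> (\<Union>m\<in>I. cbox (l' m) (u' m))"
      using m'(1) by blast
  qed
  have "nbhd_vol S \<epsilon> \<le> measure lebesgue (\<Union>m\<in>I. cbox (l' m) (u' m))"
    unfolding nbhd_vol_def using assms fin
    by (intro measure_mono_fmeasurable sub fmeasurableD lmeasurable_nbhd fmeasurable.finite_UN) auto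
  also have "\<dots> \<le> (\<Sum>m\<in>I. measure lebesgue (cbox (l' m) (u' m)))"
    by (rule measure_UNION_le[OF fin]) (auto intro: fmeasurableD)
  also have "\<dots> = real (card I) * (5 * \<epsilon>) ^ CARD('n)"
    by (simp only: vol sum_constant)
  also have "card I = box_count \<epsilon> S"
    unfolding box_count_def I(2) using I(1) by (simp add: card_image)
  finally show ?thesis .
qed

section \<open>Box dimension and Minkowski contents from parallel volumes\<close>

lemma eventually_at_right_0_scale:
  fixes P :: "real \<Rightarrow> bool"
  assumes "eventually P (at_right 0)" "k > 0"
  shows "eventually (\<lambda>x. P (k * x)) (at_right 0)"
proof -
  have "filterlim (\<lambda>x. k * x) (at_right 0) (at_right (0 :: real))"
    using assms(2) by (intro filterlim_times_pos[where p = 0]) (auto intro: filterlim_ident)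
  with assms(1) show ?thesis
    by (rule eventually_compose_filterlim)
qed

lemma powr_at_right_0:
  assumes "e > (0 :: real)"
  shows "((\<lambda>x. C * x powr e) \<longlongrightarrow> 0) (at_right (0 :: real))"
proof -
  have "((\<lambda>x. x powr e) \<longlongrightarrow> 0 powr e) (at_right (0 :: real))"
    using assms
    by (intro tendsto_powr') (auto simp: eventually_at_right_field intro!: exI[of _ 1])
  then have "((\<lambda>x. x powr e) \<longlongrightarrow> 0) (at_right (0 :: real))"
    by simp
  then show ?thesis
    by (rule tendsto_mult_right_zero)
qed

lemma powr_neg_at_right_0:
  assumes "e < (0 :: real)" "c > 0"
  shows "filterlim (\<lambda>x. c * x powr e) at_top (at_right (0 :: real))"
proof -
  have "((\<lambda>x. x powr - e) \<longlongrightarrow> 0) (at_right (0 :: real))"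
    using powr_at_right_0[of "- e" 1] assms by simp
  then have "filterlim (\<lambda>x. inverse (x powr - e)) at_top (at_right (0 :: real))"
    by (rule filterlim_inverse_at_top) (auto simp: eventually_at_right_field intro!: exI[of _ 1])
  then have "filterlim (\<lambda>x. x powr e) at_top (at_right (0 :: real))"
    by (simp add: powr_minus)
  then show ?thesis
    using assms(2) by (rule filterlim_tendsto_pos_mult_at_top[OF tendsto_const, rotated])
qed

text \<open>The upper bound may lose an arbitrarily small power \<eta>, because a dimension does not
  see logarithmic factors; this form is what the critical case \<alpha>\<delta> = 1
  requires.\<close>

lemma has_box_dimI:
  fixes S :: "(real ^ 'n) set"
  assumes S: "bounded S" and c: "c > 0"
    and lower: "eventually (\<lambda>\<epsilon>. c * \<epsilon> powr (real CARD('n) - d) \<le> nbhd_vol S \<epsilon>) (at_right 0)"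
    and upper: "\<And>\<eta>. \<eta> > 0 \<Longrightarrow>
      \<exists>C. eventually (\<lambda>\<epsilon>. nbhd_vol S \<epsilon> \<le> C * \<epsilon> powr (real CARD('n) - d - \<eta>)) (at_right 0)"
  shows "has_box_dim S d"
proof -
  define c' where "c' = c / 5 ^ CARD('n)"
  have c': "c' > 0"
    using c by (simp add: c'_def)
  have pos: "eventually (\<lambda>\<epsilon> :: real. \<epsilon> > 0) (at_right 0)"
    by (simp add: eventually_at_right_less)
  have lowerN: "eventually (\<lambda>\<epsilon>. c' * \<epsilon> powr (\<delta> - d) \<le> \<epsilon> powr \<delta> * real (box_count \<epsilon> S)) (at_right 0)" for \<delta>
    using lower pos
  proof eventually_elim
    case (elim \<epsilon>)
    have "\<epsilon> powr (real CARD('n) - d) = \<epsilon> ^ CARD('n) * \<epsilon> powr - d"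
      using elim by (simp add: powr_diff powr_minus powr_realpow divide_inverse)
    then have "c * (\<epsilon> ^ CARD('n) * \<epsilon> powr - d) \<le> real (box_count \<epsilon> S) * (5 * \<epsilon>) ^ CARD('n)"
      using order_trans[OF elim(1) nbhd_vol_le_box_count[OF S elim(2)]] by (simp only:)
    then have "c' * \<epsilon> powr - d \<le> real (box_count \<epsilon> S)"
      using elim by (simp add: c'_def field_simps power_mult_distrib)
    then have "\<epsilon> powr \<delta> * (c' * \<epsilon> powr - d) \<le> \<epsilon> powr \<delta> * real (box_count \<epsilon> S)"
      by (intro mult_left_mono) auto
    then show ?case
      by (simp add: powr_diff powr_minus divide_inverse mult_ac)
  qed
  have lim0: "((\<lambda>\<epsilon>. \<epsilon> powr \<delta> * real (box_count \<epsilon> S)) \<longlongrightarrow> 0) (at_right 0)" if "\<delta> > d" for \<delta>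
  proof -
    \<comment> \<open>Half of the gap \<open>\<delta> - d\<close> is given away as loss; the other
      half leaves the factor \<open>\<epsilon> powr \<eta>\<close>, which tends to 0.\<close>
    define \<eta> n where "\<eta> = (\<delta> - d) / 2" and "n = real CARD('n)"
    have \<eta>: "\<eta> > 0" and n: "n > 0"
      using that by (auto simp: \<eta>_def n_def)
    obtain C where C: "eventually (\<lambda>\<epsilon>. nbhd_vol S \<epsilon> \<le> C * \<epsilon> powr (n - d - \<eta>)) (at_right 0)"
      using upper[OF \<eta>] by (auto simp: n_def)
    define C' where "C' = C * n powr (n - d - \<eta>)"
    have "eventually (\<lambda>\<epsilon>. \<epsilon> powr \<delta> * real (box_count \<epsilon> S) \<le> C' * \<epsilon> powr \<eta>) (at_right 0)"
      using eventually_at_right_0_scale[OF C n] pos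
    proof eventually_elim
      case (elim \<epsilon>)
      have "real (box_count \<epsilon> S) * \<epsilon> ^ CARD('n) \<le> C * (n * \<epsilon>) powr (n - d - \<eta>)"
        using elim finite_card_mesh_le(2)[OF S, of \<epsilon>] by (simp add: n_def)
      also have "\<dots> = C' * \<epsilon> powr (- d - \<eta>) * \<epsilon> powr n"
        using elim n by (simp add: C'_def powr_mult flip: powr_add) (simp add: algebra_simps)
      also have "\<epsilon> powr n = \<epsilon> ^ CARD('n)"
        using elim by (simp add: n_def powr_realpow)
      finally have "real (box_count \<epsilon> S) \<le> C' * \<epsilon> powr (- d - \<eta>)"
        using elim by simp
      then have "\<epsilon> powr \<delta> * real (box_count \<epsilon> S) \<le> \<epsilon> powr \<delta> * (C' * \<epsilon> powr (- d - \<eta>))"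
        by (intro mult_left_mono) auto
      also have "\<dots> = C' * \<epsilon> powr (\<delta> + (- d - \<eta>))"
        by (simp add: powr_add)
      also have "\<delta> + (- d - \<eta>) = \<eta>"
        by (simp add: \<eta>_def field_simps)
      finally show ?case .
    qed
    then show ?thesis
      by (intro tendsto_sandwich[OF _ _ tendsto_const powr_at_right_0[OF \<eta>]])
         (auto intro: always_eventually)
  qed
  have limtop: "filterlim (\<lambda>\<epsilon>. \<epsilon> powr \<delta> * real (box_count \<epsilon> S)) at_top (at_right 0)"
    if "\<delta> < d" for \<delta>
    by (rule filterlim_at_top_mono[OF powr_neg_at_right_0 lowerN]) (use that c' in auto)
  \<comment> \<open>No exponent can produce both limits, so the set of exponents in the infimum
    stays above \<open>d\<close> and the one in the supremum stays below \<open>d\<close>.\<close>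
  have not_both: False
    if "(f \<longlongrightarrow> 0) (at_right 0)" "filterlim f at_top (at_right 0)" for f :: "real \<Rightarrow> real"
    using not_tendsto_and_filterlim_at_infinity[OF _ that(1) filterlim_at_top_imp_at_infinity[OF that(2)]]
    by simp
  have "upper_box_dim S = ereal d"
  proof (rule antisym)
    show "upper_box_dim S \<le> ereal d"
    proof (rule ereal_le_epsilon2[rule_format])
      fix e :: real assume "e > 0"
      then show "upper_box_dim S \<le> ereal d + ereal e"
        unfolding upper_box_dim_def using lim0[of "d + e"] by (intro Inf_lower) auto
    qed
    show "ereal d \<le> upper_box_dim S"
      unfolding upper_box_dim_def using limtop not_both
      by (intro Inf_greatest) (auto intro!: leI dest: not_both)
  qed
  moreover have "lower_box_dim S = ereal d"
  proof (rule antisym)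
    show "lower_box_dim S \<le> ereal d"
      unfolding lower_box_dim_def
      by (intro Sup_least) (auto intro!: leI dest: not_both[OF lim0])
    show "ereal d \<le> lower_box_dim S"
    proof (rule ereal_le_epsilon2[rule_format])
      fix e :: real assume "e > 0"
      then have "ereal (d - e) \<le> lower_box_dim S"
        unfolding lower_box_dim_def using limtop[of "d - e"] by (intro Sup_upper) auto
      then show "ereal d \<le> lower_box_dim S + ereal e"
        by (cases "lower_box_dim S") auto
    qed
  qed
  ultimately show ?thesis
    by (simp add: has_box_dim_def)
qed

section \<open>Minkowski non-degeneracy as two-sided power bounds\<close>

text \<open>The volume at small radii is at most the volume at radius 1, whereas a negative power
  blows up. Applied to \<open>p = n - d\<close>, this gives \<open>d \<le> n\<close>, hence a
  positive normalising constant, and it makes \<open>r powr p\<close> monotone.\<close>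

lemma nbhd_vol_exponent_nonneg:
  assumes "bounded S" "c > 0"
    and lower: "eventually (\<lambda>\<epsilon>. c * \<epsilon> powr p \<le> nbhd_vol S \<epsilon>) (at_right 0)"
  shows "p \<ge> 0"
proof (rule ccontr)
  assume "\<not> p \<ge> 0"
  then have "filterlim (\<lambda>x. c * x powr p) at_top (at_right (0 :: real))"
    using assms(2) by (intro powr_neg_at_right_0) auto
  then have "eventually (\<lambda>\<epsilon>. nbhd_vol S 1 < c * \<epsilon> powr p) (at_right 0)"
    by (simp add: filterlim_at_top_dense)
  moreover have "eventually (\<lambda>\<epsilon> :: real. \<epsilon> < 1) (at_right 0)"
    by (rule eventually_at_right_real[THEN eventually_mono, of 0 1]) auto
  ultimately have "eventually (\<lambda>\<epsilon> :: real. False) (at_right 0)"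
    using lower
  proof eventually_elim
    case (elim \<epsilon>)
    then show ?case
      using nbhd_vol_mono[OF assms(1) subset_refl, of \<epsilon> 1] by simp
  qed
  then show False
    by simp
qed

lemma ball_const_pos: "x \<ge> 0 \<Longrightarrow> ball_const x > 0"
  by (simp add: ball_const_def)

lemma has_nondegenerate_box_dimI:
  fixes S :: "(real ^ 'n) set"
  assumes S: "bounded S" and c: "c > 0"
    and lower: "eventually (\<lambda>\<epsilon>. c * \<epsilon> powr (real CARD('n) - d) \<le> nbhd_vol S \<epsilon>) (at_right 0)"
    and upper: "eventually (\<lambda>\<epsilon>. nbhd_vol S \<epsilon> \<le> C * \<epsilon> powr (real CARD('n) - d)) (at_right 0)"
  shows "has_nondegenerate_box_dim S d"
proof -
  define p where "p = real CARD('n) - d"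
  have pos: "eventually (\<lambda>\<epsilon> :: real. \<epsilon> > 0) (at_right 0)"
    by (simp add: eventually_at_right_less)
  have lt1: "eventually (\<lambda>\<epsilon> :: real. \<epsilon> < 1) (at_right 0)"
    by (rule eventually_at_right_real[THEN eventually_mono, of 0 1]) auto
  have "p \<ge> 0"
    unfolding p_def by (rule nbhd_vol_exponent_nonneg[OF S c lower])
  then have \<gamma>: "ball_const p > 0"
    by (rule ball_const_pos)
  have "has_box_dim S d"
  proof (rule has_box_dimI[OF S c lower])
    fix \<eta> :: real assume "\<eta> > 0"
    \<comment> \<open>The sign of \<open>C\<close> is unknown, and raising the power of \<epsilon>
      is monotone only with a nonnegative coefficient.\<close>
    have "eventually (\<lambda>\<epsilon>. nbhd_vol S \<epsilon> \<le> max 0 C * \<epsilon> powr (real CARD('n) - d - \<eta>)) (at_right 0)"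
      using upper pos lt1
    proof eventually_elim
      case (elim \<epsilon>)
      have "C * \<epsilon> powr (real CARD('n) - d) \<le> max 0 C * \<epsilon> powr (real CARD('n) - d - \<eta>)"
        using elim \<open>\<eta> > 0\<close> by (intro mult_mono powr_mono') auto
      with elim show ?case
        by simp
    qed
    then show "\<exists>C. eventually (\<lambda>\<epsilon>. nbhd_vol S \<epsilon> \<le> C * \<epsilon> powr (real CARD('n) - d - \<eta>)) (at_right 0)"
      by blast
  qed
  moreover have "upper_mink_content d S < \<infinity>"
  proof -
    have "eventually (\<lambda>\<epsilon>. ereal (mink_ratio d \<epsilon> S) \<le> ereal (C / ball_const p)) (at_right 0)"
      using upper pos
      by eventually_elim (use \<gamma> in \<open>simp add: mink_ratio_def field_simps p_def flip: nbhd_vol_def\<close>)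
    then have "upper_mink_content d S \<le> ereal (C / ball_const p)"
      unfolding upper_mink_content_def by (rule Limsup_bounded)
    then show ?thesis
      by auto
  qed
  moreover have "lower_mink_content d S > 0"
  proof -
    have "eventually (\<lambda>\<epsilon>. ereal (c / ball_const p) \<le> ereal (mink_ratio d \<epsilon> S)) (at_right 0)"
      using lower pos
      by eventually_elim (use \<gamma> in \<open>simp add: mink_ratio_def field_simps p_def flip: nbhd_vol_def\<close>)
    then have "ereal (c / ball_const p) \<le> lower_mink_content d S"
      unfolding lower_mink_content_def by (rule Liminf_bounded)
    moreover have "ereal (c / ball_const p) > 0"
      using c \<gamma> by simp
    ultimately show ?thesis
      by (rule less_le_trans[rotated])
  qed
  ultimately show ?thesis
    by (simp add: has_nondegenerate_box_dim_def)
qed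

lemma has_nondegenerate_box_dimD:
  fixes S :: "(real ^ 'n) set"
  assumes "has_nondegenerate_box_dim S d"
  obtains c C where "c > 0"
    "eventually (\<lambda>\<epsilon>. c * \<epsilon> powr (real CARD('n) - d) \<le> nbhd_vol S \<epsilon>) (at_right 0)"
    "eventually (\<lambda>\<epsilon>. nbhd_vol S \<epsilon> \<le> C * \<epsilon> powr (real CARD('n) - d)) (at_right 0)"
proof -
  define p where "p = real CARD('n) - d"
  have pos: "eventually (\<lambda>\<epsilon> :: real. \<epsilon> > 0) (at_right 0)"
    by (simp add: eventually_at_right_less)
  have "upper_mink_content d S < \<infinity>" "lower_mink_content d S > 0"
    using assms by (auto simp: has_nondegenerate_box_dim_def)
  then obtain B b where B: "upper_mink_content d S < ereal B"
    and b: "0 < ereal b" "ereal b < lower_mink_content d S"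
    using ereal_dense2 by blast
  have lo: "eventually (\<lambda>\<epsilon>. b < mink_ratio d \<epsilon> S) (at_right 0)"
    using less_LiminfD[OF b(2)[unfolded lower_mink_content_def]] by simp
  have up: "eventually (\<lambda>\<epsilon>. mink_ratio d \<epsilon> S < B) (at_right 0)"
    using Limsup_lessD[OF B[unfolded upper_mink_content_def]] by simp
  \<comment> \<open>The inequality \<open>d \<le> n\<close> is not yet known here. A ratio with
    nonnegative numerator that exceeds \<open>b > 0\<close> forces its denominator to be positive;
    the statement is constant in \<epsilon>, so one small \<epsilon> is enough.\<close>
  have "eventually (\<lambda>\<epsilon> :: real. ball_const p > 0) (at_right 0)"
    using lo pos
  proof eventually_elim
    case (elim \<epsilon>)
    then have "mink_ratio d \<epsilon> S > 0"
      using b(1) by simp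
    then show ?case
      using elim by (simp add: mink_ratio_def p_def zero_less_divide_iff zero_less_mult_iff
          measure_nonneg[THEN leD] not_less[symmetric])
  qed
  then have \<gamma>: "ball_const p > 0"
    by simp
  show thesis
  proof (rule that[of "b * ball_const p" "B * ball_const p"])
    show "b * ball_const p > 0"
      using b(1) \<gamma> by simp
    show "eventually (\<lambda>\<epsilon>. b * ball_const p * \<epsilon> powr (real CARD('n) - d) \<le> nbhd_vol S \<epsilon>) (at_right 0)"
      using lo pos
      by eventually_elim (use \<gamma> in \<open>simp add: mink_ratio_def field_simps p_def flip: nbhd_vol_def\<close>)
    show "eventually (\<lambda>\<epsilon>. nbhd_vol S \<epsilon> \<le> B * ball_const p * \<epsilon> powr (real CARD('n) - d)) (at_right 0)"
      using up pos
      by eventually_elim (use \<gamma> in \<open>simp add: mink_ratio_def field_simps p_def flip: nbhd_vol_def\<close>)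
  qed
qed

text \<open>A layer of scale t at radius \<epsilon> is governed by the radius
  \<open>\<epsilon> / t\<close> of \<open>S\<close>, which need not be small; hence bounds on a
  whole interval are wanted. Away from 0, the volume and \<open>r powr p\<close> are both monotone
  and lie between positive constants or the values at \<open>a\<close> and \<open>R\<close>, so
  adjusting the constants suffices.\<close>

lemma nbhd_vol_bounds_extend:
  assumes S: "bounded S" and c: "c > 0"
    and lower: "eventually (\<lambda>\<epsilon>. c * \<epsilon> powr p \<le> nbhd_vol S \<epsilon>) (at_right 0)"
    and upper: "eventually (\<lambda>\<epsilon>. nbhd_vol S \<epsilon> \<le> C * \<epsilon> powr p) (at_right 0)"
    and R: "R > 0"
  obtains c' C' where "c' > 0" "C' > 0"
    "\<And>r. 0 < r \<Longrightarrow> r \<le> R \<Longrightarrow> c' * r powr p \<le> nbhd_vol S r"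
    "\<And>r. 0 < r \<Longrightarrow> r \<le> R \<Longrightarrow> nbhd_vol S r \<le> C' * r powr p"
proof -
  have p: "p \<ge> 0"
    using nbhd_vol_exponent_nonneg[OF S c lower] .
  obtain e where e: "e > 0"
    and eb: "\<And>r. 0 < r \<Longrightarrow> r < e \<Longrightarrow> c * r powr p \<le> nbhd_vol S r \<and> nbhd_vol S r \<le> C * r powr p"
    using eventually_conj[OF lower upper] unfolding eventually_at_right_field by auto
  define a where "a = e / 2"
  have a: "a > 0" "a < e"
    using e by (auto simp: a_def)
  define c' where "c' = min c (c * a powr p / R powr p)"
  define C' where "C' = max 1 (max C (nbhd_vol S R / a powr p))"
  show thesis
  proof (rule that[of c' C'])
    show "c' > 0" "C' > 0"
      using c a R by (auto simp: c'_def C'_def)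
    fix r assume r: "0 < r" "r \<le> R"
    show "c' * r powr p \<le> nbhd_vol S r"
    proof (cases "r < e")
      case True
      have "c' * r powr p \<le> c * r powr p"
        by (intro mult_right_mono) (auto simp: c'_def)
      with eb[OF r(1) True] show ?thesis
        by simp
    next
      case False
      have "c' * r powr p \<le> (c * a powr p / R powr p) * R powr p"
        using r c p by (intro mult_mono powr_mono2) (auto simp: c'_def)
      also have "\<dots> = c * a powr p"
        using R by simp
      also have "\<dots> \<le> nbhd_vol S r"
        using eb[OF a] nbhd_vol_mono[OF S subset_refl, of a r] False a by simp
      finally show ?thesis .
    qed
    show "nbhd_vol S r \<le> C' * r powr p"
    proof (cases "r < e")
      case True
      have "C * r powr p \<le> C' * r powr p"
        by (intro mult_right_mono) (auto simp: C'_def)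
      with eb[OF r(1) True] show ?thesis
        by simp
    next
      case False
      have "nbhd_vol S r \<le> (nbhd_vol S R / a powr p) * a powr p"
        using nbhd_vol_mono[OF S subset_refl, of r R] r a by simp
      also have "\<dots> \<le> C' * r powr p"
        using False a p by (intro mult_mono powr_mono2) (auto simp: C'_def)
      finally show ?thesis .
    qed
  qed
qed

section \<open>The layers of a fractal nest\<close>

text \<open>Discrete form of comparison with the integral. The induction step is the weighted AM-GM
  inequality for \<open>K\<close> and \<open>K + 1\<close> with weights \<open>1 - s\<close> and
  \<open>s\<close>, divided by \<open>(K + 1) powr s\<close>.\<close>

lemma sum_powr_neg_le:
  assumes "0 \<le> s" "s < (1 :: real)"
  shows "(\<Sum>k=1..K. real k powr - s) \<le> real K powr (1 - s) / (1 - s)"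
proof (induction K)
  case (Suc K)
  have "real K powr (1 - s) + (1 - s) * real (Suc K) powr - s \<le> real (Suc K) powr (1 - s)"
  proof -
    define x where "x = real (Suc K)"
    have x: "x > 0"
      by (simp add: x_def)
    have "real K powr (1 - s) * x powr s \<le> (1 - s) * real K + s * x"
    proof (cases "K = 0")
      case False
      then show ?thesis
        using assms x by (intro Youngs_inequality_0) auto
    qed (use assms x in simp)
    also have "\<dots> = x - (1 - s)"
      by (simp add: x_def algebra_simps)
    finally have "real K powr (1 - s) \<le> (x - (1 - s)) / x powr s"
      using x by (simp add: field_simps)
    also have "\<dots> = x powr (1 - s) - (1 - s) * x powr - s"
      using x by (simp add: powr_diff powr_minus diff_divide_distrib divide_inverse algebra_simps)
    finally show ?thesis
      by (simp add: x_def)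
  qed
  moreover have "(1 - s) * (\<Sum>k=1..K. real k powr - s) \<le> real K powr (1 - s)"
    using Suc assms by (simp add: pos_le_divide_eq mult.commute)
  ultimately have "(1 - s) * (\<Sum>k=1..Suc K. real k powr - s) \<le> real (Suc K) powr (1 - s)"
    by (simp add: distrib_left)
  then show ?case
    using assms by (simp add: pos_le_divide_eq mult.commute)
qed simp

text \<open>The convex function \<open>x powr - \<alpha>\<close> lies above its tangent at
  \<open>y\<close>; this follows from \<open>1 + u \<le> exp u\<close> and
  \<open>ln z \<le> z - 1\<close>. For integers it bounds from below the distance between the radii
  of two layers.\<close>

lemma powr_neg_gap:
  assumes "0 < x" "x < y" "\<alpha> > (0 :: real)"
  shows "y powr - \<alpha> + \<alpha> * (y - x) * y powr (- \<alpha> - 1) \<le> x powr - \<alpha>"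
proof -
  have "1 + \<alpha> * (1 - x / y) \<le> exp (\<alpha> * (1 - x / y))"
    by (rule exp_ge_add_one_self)
  also have "\<dots> \<le> exp (- \<alpha> * ln (x / y))"
  proof -
    have "\<alpha> * (1 - x / y) \<le> \<alpha> * (- ln (x / y))"
      using ln_le_minus_one[of "x / y"] assms by (intro mult_left_mono) auto
    then show ?thesis
      by simp
  qed
  also have "\<dots> = x powr - \<alpha> / y powr - \<alpha>"
    using assms by (simp add: powr_def ln_div algebra_simps flip: exp_diff)
  finally have "y powr - \<alpha> * (1 + \<alpha> * (1 - x / y)) \<le> x powr - \<alpha>"
    using assms by (simp add: field_simps)
  then show ?thesis
    using assms by (simp add: powr_diff field_simps)
qed

section \<open>Volume and position of a single layer\<close>

lemma power_mult_powr_divide: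
  fixes t r a \<delta> :: real
  assumes "t > 0" "r > 0"
  shows "t ^ n * (a * (r / t) powr (real n - \<delta>)) = a * r powr (real n - \<delta>) * t powr \<delta>"
proof -
  have "t ^ n = t powr ((real n - \<delta>) + \<delta>)"
    using assms by (simp add: powr_realpow)
  then show ?thesis
    using assms by (simp only: powr_add powr_divide) simp
qed

lemma nbhd_vol_scaling_ge:
  fixes S :: "(real ^ 'n) set"
  assumes "\<And>r. 0 < r \<Longrightarrow> r \<le> R \<Longrightarrow> c * r powr (real CARD('n) - \<delta>) \<le> nbhd_vol S r"
    and "0 < t" "0 < r" "r \<le> R * t"
  shows "c * r powr (real CARD('n) - \<delta>) * t powr \<delta> \<le> nbhd_vol (scaling t S) r"
  unfolding power_mult_powr_divide[OF assms(2,3), symmetric] nbhd_vol_scaling[OF assms(2)]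
  using assms by (intro mult_left_mono) (auto simp: pos_divide_le_eq)

lemma nbhd_vol_scaling_le:
  fixes S :: "(real ^ 'n) set"
  assumes "\<And>r. 0 < r \<Longrightarrow> r \<le> R \<Longrightarrow> nbhd_vol S r \<le> C * r powr (real CARD('n) - \<delta>)"
    and "0 < t" "0 < r" "r \<le> R * t"
  shows "nbhd_vol (scaling t S) r \<le> C * r powr (real CARD('n) - \<delta>) * t powr \<delta>"
  unfolding power_mult_powr_divide[OF assms(2,3), symmetric] nbhd_vol_scaling[OF assms(2)]
  using assms by (intro mult_left_mono) (auto simp: pos_divide_le_eq)

text \<open>A layer lies on the sphere of radius \<open>t\<close>, so its neighbourhood lies in a
  shell of half-width \<open>r\<close>. Layers whose radii differ by more than \<open>2 * r\<close>
  thus have disjoint neighbourhoods.\<close>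

lemma norm_nbhd_scaling:
  assumes "S \<subseteq> sphere 0 1" "t > 0" "x \<in> nbhd (scaling t S) r"
  shows "\<bar>norm x - t\<bar> \<le> r"
proof (rule dense_ge)
  fix e assume "r < e"
  with assms(3) obtain s where s: "s \<in> scaling t S" "dist x s < e"
    by (rule mem_nbhdE)
  have "norm s = t"
    using s(1) assms(1,2) by (auto simp: scaling_def)
  then show "\<bar>norm x - t\<bar> \<le> e"
    using s(2) norm_triangle_ineq3[of x s] by (simp add: dist_norm)
qed

lemma bounded_scaling_set: "bounded S \<Longrightarrow> bounded (scaling t S)"
  unfolding scaling_def by (rule bounded_scaling)

lemma bounded_fractal_nest:
  assumes "S \<subseteq> sphere 0 1" "\<alpha> \<ge> 0"
  shows "bounded (fractal_nest \<alpha> S)"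
proof -
  have "norm x \<le> 1" if "x \<in> fractal_nest \<alpha> S" for x
  proof -
    obtain k s where ks: "k \<ge> 1" "s \<in> S" "x = (real k powr - \<alpha>) *\<^sub>R s"
      using \<open>x \<in> fractal_nest \<alpha> S\<close> by (auto simp: fractal_nest_def scaling_def)
    have "real k powr - \<alpha> \<le> real k powr 0"
      using ks(1) assms(2) by (intro powr_mono) auto
    then show ?thesis
      using ks assms(1) by auto
  qed
  then show ?thesis
    unfolding bounded_iff by blast
qed

lemma fractal_nest_superset: "S \<subseteq> fractal_nest \<alpha> S"
  by (force simp: fractal_nest_def scaling_def)

section \<open>Upper estimate for the nest\<close>

lemma nbhd_fractal_nest_subset:
  assumes S: "S \<subseteq> sphere 0 1" and \<alpha>: "\<alpha> > 0" and \<epsilon>: "\<epsilon> > 0"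
    and M: "M > 0" "M powr - \<alpha> = M * \<epsilon>"
  shows "nbhd (fractal_nest \<alpha> S) \<epsilon> \<subseteq>
      (\<Union>k\<in>{1..nat \<lfloor>M\<rfloor>}. nbhd (scaling (real k powr - \<alpha>) S) (3 * \<epsilon>)) \<union>
      (\<Union>j\<in>{1..nat \<lceil>M\<rceil>}. nbhd (scaling (real j * \<epsilon>) S) (3 * \<epsilon>))"
proof
  fix x assume "x \<in> nbhd (fractal_nest \<alpha> S) \<epsilon>"
  then obtain a where a: "a \<in> fractal_nest \<alpha> S" "dist x a < 2 * \<epsilon>"
    by (rule mem_nbhdE[where e = "2 * \<epsilon>"]) (use \<epsilon> in auto)
  obtain k s where ks: "k \<ge> 1" "s \<in> S" "a = (real k powr - \<alpha>) *\<^sub>R s"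
    using a(1) by (auto simp: fractal_nest_def scaling_def)
  show "x \<in> (\<Union>k\<in>{1..nat \<lfloor>M\<rfloor>}. nbhd (scaling (real k powr - \<alpha>) S) (3 * \<epsilon>)) \<union>
      (\<Union>j\<in>{1..nat \<lceil>M\<rceil>}. nbhd (scaling (real j * \<epsilon>) S) (3 * \<epsilon>))"
  proof (cases "k \<le> nat \<lfloor>M\<rfloor>")
    case True
    have "x \<in> nbhd (scaling (real k powr - \<alpha>) S) (3 * \<epsilon>)"
      by (rule mem_nbhdI[of a]) (use a ks \<epsilon> in \<open>auto simp: scaling_def\<close>)
    with True ks(1) show ?thesis
      by auto
  next
    case False
    define t where "t = real k powr - \<alpha>"
    \<comment> \<open>The radius \<open>t\<close> is rounded up to a multiple of \<epsilon>.
      Rounding up keeps \<open>j \<ge> 1\<close>, so no copy degenerates to a point. The rounding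
      costs at most \<epsilon>, and \<open>dist x a\<close> is below \<open>2 * \<epsilon>\<close>;
      together they give \<open>3 * \<epsilon>\<close>.\<close>
    define j where "j = nat \<lceil>t / \<epsilon>\<rceil>"
    have "M < real k"
      using False M(1) by linarith
    then have "t \<le> M powr - \<alpha>"
      unfolding t_def using M(1) \<alpha> by (intro powr_mono2') auto
    then have "t / \<epsilon> \<le> M"
      using M(2) \<epsilon> by (simp add: pos_divide_le_eq)
    then have "j \<le> nat \<lceil>M\<rceil>"
      unfolding j_def by (intro nat_mono ceiling_mono)
    have "t > 0"
      using ks(1) by (simp add: t_def)
    then have "t / \<epsilon> > 0"
      using \<epsilon> by simp
    then have "j \<ge> 1" and j: "t / \<epsilon> \<le> real j" "real j < t / \<epsilon> + 1"
      unfolding j_def by linarith+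
    then have "\<bar>t - real j * \<epsilon>\<bar> \<le> \<epsilon>"
      using \<epsilon> by (simp add: field_simps abs_le_iff)
    moreover have "dist a ((real j * \<epsilon>) *\<^sub>R s) = \<bar>t - real j * \<epsilon>\<bar>"
      using ks S by (auto simp: dist_norm t_def simp flip: scaleR_diff_left)
    ultimately have "dist x ((real j * \<epsilon>) *\<^sub>R s) \<le> 3 * \<epsilon>"
      using a(2) dist_triangle[of x "(real j * \<epsilon>) *\<^sub>R s" a] by simp
    then have "x \<in> nbhd (scaling (real j * \<epsilon>) S) (3 * \<epsilon>)"
      using ks(2) by (intro mem_nbhdI) (auto simp: scaling_def)
    with \<open>j \<ge> 1\<close> \<open>j \<le> nat \<lceil>M\<rceil>\<close> show ?thesis
      by auto
  qed
qed

text \<open>\<open>M\<close> is the solution of \<open>M powr - \<alpha> = M * \<epsilon>\<close>: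
  the radius at index \<open>M\<close> equals \<open>M\<close> steps of length \<epsilon>. The last
  claim keeps \<open>\<epsilon> / t \<le> 1\<close> for all layers up to \<open>M\<close>, the range
  in which the bounds on \<open>S\<close> apply.\<close>

lemma fractal_nest_cutoff:
  fixes \<alpha> \<epsilon> :: real
  assumes "\<alpha> > 0" "0 < \<epsilon>" "\<epsilon> \<le> 1"
  defines "M \<equiv> \<epsilon> powr (- 1 / (\<alpha> + 1))"
  shows "M \<ge> 1" "M powr - \<alpha> = M * \<epsilon>" "\<And>x. x > 0 \<Longrightarrow> x \<le> M \<Longrightarrow> \<epsilon> \<le> x powr - \<alpha>"
proof -
  have "1 powr (- 1 / (\<alpha> + 1)) \<le> \<epsilon> powr (- 1 / (\<alpha> + 1))"
    using assms by (intro powr_mono2') auto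
  then show M: "M \<ge> 1"
    by (simp add: M_def)
  have "- 1 / (\<alpha> + 1) * - \<alpha> = - 1 / (\<alpha> + 1) + 1"
    using assms(1) by (simp add: field_simps)
  then have "M powr - \<alpha> = \<epsilon> powr (- 1 / (\<alpha> + 1) + 1)"
    by (simp only: M_def powr_powr)
  also have "\<dots> = M * \<epsilon>"
    unfolding M_def powr_add using assms(2) by simp
  finally show eq: "M powr - \<alpha> = M * \<epsilon>" .
  show "\<epsilon> \<le> x powr - \<alpha>" if "x > 0" "x \<le> M" for x
  proof -
    have "\<epsilon> \<le> M * \<epsilon>"
      using M assms(2) by simp
    also have "\<dots> \<le> x powr - \<alpha>"
      using that assms(1) by (subst eq[symmetric], intro powr_mono2') auto
    finally show ?thesis .
  qed
qed

lemma nbhd_vol_fractal_nest_le: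
  fixes S :: "(real ^ 'n) set"
  assumes S: "S \<subseteq> sphere 0 1" and \<alpha>: "\<alpha> > 0" and \<delta>: "\<delta> \<ge> 0" and C: "C > 0"
    and bounds: "\<And>r. 0 < r \<Longrightarrow> r \<le> 3 \<Longrightarrow> nbhd_vol S r \<le> C * r powr (real CARD('n) - \<delta>)"
  obtains C' where "C' > 0"
    "\<And>\<epsilon>. 0 < \<epsilon> \<Longrightarrow> \<epsilon> \<le> 1 \<Longrightarrow> nbhd_vol (fractal_nest \<alpha> S) \<epsilon> \<le> C' * \<epsilon> powr (real CARD('n) - \<delta>) *
      ((\<Sum>k=1..nat \<lfloor>\<epsilon> powr (- 1 / (\<alpha> + 1))\<rfloor>. real k powr - (\<alpha> * \<delta>)) +
       \<epsilon> powr (- (1 - \<alpha> * \<delta>) / (\<alpha> + 1)))"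
proof -
  define p where "p = real CARD('n) - \<delta>"
  \<comment> \<open>\<open>D\<close> absorbs \<open>3 powr p\<close> from the radius
    \<open>3 * \<epsilon>\<close>. \<open>B\<close> collects a 2 from having at most
    \<open>2 * M\<close> copies and \<open>2 powr \<delta>\<close> from their scales being at most
    \<open>2 * M * \<epsilon>\<close>.\<close>
  define D where "D = C * 3 powr p"
  define B where "B = 2 * 2 powr \<delta>"
  have D: "D > 0"
    using C by (simp add: D_def)
  have B: "B \<ge> 1"
    using \<delta> ge_one_powr_ge_zero[of 2 \<delta>] by (simp add: B_def)
  have bdd: "bounded (scaling t S)" for t
    using S bounded_subset bounded_sphere by (blast intro: bounded_scaling_set)
  show thesis
  proof (rule that[of "D * B"])
    show "D * B > 0"
      using D B by simp
    fix \<epsilon> :: real assume \<epsilon>: "0 < \<epsilon>" "\<epsilon> \<le> 1"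
    define M where "M = \<epsilon> powr (- 1 / (\<alpha> + 1))"
    note M = fractal_nest_cutoff[OF \<alpha> \<epsilon>, folded M_def]
    \<comment> \<open>The condition \<open>t \<ge> \<epsilon>\<close> says that
      \<open>3 * \<epsilon> / t \<le> 3\<close>, which is why the bound on \<open>S\<close> is taken
      up to radius 3.\<close>
    have layer: "nbhd_vol (scaling t S) (3 * \<epsilon>) \<le> D * \<epsilon> powr p * t powr \<delta>" if "t \<ge> \<epsilon>" for t
    proof -
      have "nbhd_vol (scaling t S) (3 * \<epsilon>) \<le> C * (3 * \<epsilon>) powr p * t powr \<delta>"
        unfolding p_def
        by (rule nbhd_vol_scaling_le[where R = 3])
           (use that \<epsilon> in \<open>auto intro: bounds\<close>)
      then show ?thesis
        using \<epsilon> by (simp add: D_def powr_mult mult_ac)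
    qed
    let ?U = "\<Union>k\<in>{1..nat \<lfloor>M\<rfloor>}. nbhd (scaling (real k powr - \<alpha>) S) (3 * \<epsilon>)"
    let ?W = "\<Union>j\<in>{1..nat \<lceil>M\<rceil>}. nbhd (scaling (real j * \<epsilon>) S) (3 * \<epsilon>)"
    have meas: "?U \<in> lmeasurable" "?W \<in> lmeasurable"
      by (auto intro!: fmeasurable.finite_UN lmeasurable_nbhd bdd)
    have "nbhd_vol (fractal_nest \<alpha> S) \<epsilon> \<le> measure lebesgue (?U \<union> ?W)"
      unfolding nbhd_vol_def
    proof (rule measure_mono_fmeasurable)
      show "nbhd (fractal_nest \<alpha> S) \<epsilon> \<subseteq> ?U \<union> ?W"
        using M \<epsilon> by (intro nbhd_fractal_nest_subset S \<alpha>) auto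
      show "nbhd (fractal_nest \<alpha> S) \<epsilon> \<in> sets lebesgue"
        using S \<alpha> by (intro fmeasurableD lmeasurable_nbhd bounded_fractal_nest) auto
    qed (use meas in auto)
    also have "\<dots> \<le> measure lebesgue ?U + measure lebesgue ?W"
      using meas by (intro measure_Un_le) auto
    also have "measure lebesgue ?U \<le> (\<Sum>k=1..nat \<lfloor>M\<rfloor>. nbhd_vol (scaling (real k powr - \<alpha>) S) (3 * \<epsilon>))"
      unfolding nbhd_vol_def
      by (intro measure_UNION_le) (auto intro: fmeasurableD lmeasurable_nbhd bdd)
    also have "\<dots> \<le> (\<Sum>k=1..nat \<lfloor>M\<rfloor>. D * \<epsilon> powr p * real k powr - (\<alpha> * \<delta>))"
    proof (rule sum_mono)
      fix k assume "k \<in> {1..nat \<lfloor>M\<rfloor>}"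
      then have k: "0 < real k" "real k \<le> M"
        using M(1) by (auto simp: le_nat_iff le_floor_iff)
      show "nbhd_vol (scaling (real k powr - \<alpha>) S) (3 * \<epsilon>) \<le> D * \<epsilon> powr p * real k powr - (\<alpha> * \<delta>)"
        using layer[OF M(3)[OF k]] by (simp add: powr_powr)
    qed
    also have "measure lebesgue ?W \<le> (\<Sum>j=1..nat \<lceil>M\<rceil>. nbhd_vol (scaling (real j * \<epsilon>) S) (3 * \<epsilon>))"
      unfolding nbhd_vol_def
      by (intro measure_UNION_le) (auto intro: fmeasurableD lmeasurable_nbhd bdd)
    \<comment> \<open>Each copy is replaced by the largest possible one; since \<delta> \<ge> 0,
      this costs only a constant factor in the final bound.\<close>
    also have "\<dots> \<le> (\<Sum>j=1..nat \<lceil>M\<rceil>. D * \<epsilon> powr p * (2 * M * \<epsilon>) powr \<delta>)"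
    proof (rule sum_mono)
      fix j assume "j \<in> {1..nat \<lceil>M\<rceil>}"
      then have j: "1 \<le> real j" "real j \<le> 2 * M"
        using M(1) by (simp, simp, linarith)
      have "nbhd_vol (scaling (real j * \<epsilon>) S) (3 * \<epsilon>) \<le> D * \<epsilon> powr p * (real j * \<epsilon>) powr \<delta>"
        using j \<epsilon> by (intro layer) auto
      also have "\<dots> \<le> D * \<epsilon> powr p * (2 * M * \<epsilon>) powr \<delta>"
        using j \<epsilon> \<delta> D by (intro mult_left_mono powr_mono2) auto
      finally show "nbhd_vol (scaling (real j * \<epsilon>) S) (3 * \<epsilon>) \<le> D * \<epsilon> powr p * (2 * M * \<epsilon>) powr \<delta>" .
    qed
    also have "\<dots> = D * \<epsilon> powr p * (real (nat \<lceil>M\<rceil>) * (2 * M * \<epsilon>) powr \<delta>)"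
      by simp
    also have "\<dots> \<le> D * \<epsilon> powr p * ((2 * M) * (2 * M * \<epsilon>) powr \<delta>)"
    proof -
      have "real (nat \<lceil>M\<rceil>) \<le> 2 * M"
        using M(1) by linarith
      then show ?thesis
        using D by (intro mult_left_mono mult_right_mono) auto
    qed
    also have "(2 * M) * (2 * M * \<epsilon>) powr \<delta> = B * (M powr 1 * (M powr - \<alpha>) powr \<delta>)"
      unfolding M(2) using M(1) \<epsilon> by (simp add: B_def powr_mult)
    also have "M powr 1 * (M powr - \<alpha>) powr \<delta> = M powr (1 - \<alpha> * \<delta>)"
      unfolding powr_powr powr_add[symmetric] by simp
    also have "(\<Sum>k=1..nat \<lfloor>M\<rfloor>. D * \<epsilon> powr p * real k powr - (\<alpha> * \<delta>)) =
        D * \<epsilon> powr p * (\<Sum>k=1..nat \<lfloor>M\<rfloor>. real k powr - (\<alpha> * \<delta>))"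
      by (simp add: sum_distrib_left)
    also have "\<dots> \<le> D * \<epsilon> powr p * (B * (\<Sum>k=1..nat \<lfloor>M\<rfloor>. real k powr - (\<alpha> * \<delta>)))"
    proof -
      have "1 * (\<Sum>k=1..nat \<lfloor>M\<rfloor>. real k powr - (\<alpha> * \<delta>)) \<le> B * (\<Sum>k=1..nat \<lfloor>M\<rfloor>. real k powr - (\<alpha> * \<delta>))"
        using B by (intro mult_right_mono sum_nonneg) auto
      then show ?thesis
        using D by (intro mult_left_mono) auto
    qed
    finally have "nbhd_vol (fractal_nest \<alpha> S) \<epsilon> \<le>
        D * B * \<epsilon> powr p * ((\<Sum>k=1..nat \<lfloor>M\<rfloor>. real k powr - (\<alpha> * \<delta>)) + M powr (1 - \<alpha> * \<delta>))"
      by (simp add: algebra_simps)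
    also have "M powr (1 - \<alpha> * \<delta>) = \<epsilon> powr (- (1 - \<alpha> * \<delta>) / (\<alpha> + 1))"
      by (simp only: M_def powr_powr times_divide_eq_left mult_minus1)
    finally show "nbhd_vol (fractal_nest \<alpha> S) \<epsilon> \<le> D * B * \<epsilon> powr (real CARD('n) - \<delta>) *
        ((\<Sum>k=1..nat \<lfloor>\<epsilon> powr (- 1 / (\<alpha> + 1))\<rfloor>. real k powr - (\<alpha> * \<delta>)) +
         \<epsilon> powr (- (1 - \<alpha> * \<delta>) / (\<alpha> + 1)))"
      by (simp only: M_def p_def)
  qed
qed

section \<open>Lower estimate from disjoint layers\<close>

lemma nbhd_vol_fractal_nest_ge:
  fixes S :: "(real ^ 'n) set"
  assumes S: "S \<subseteq> sphere 0 1" and \<alpha>: "\<alpha> > 0" and \<delta>: "\<delta> \<ge> 0" "\<alpha> * \<delta> \<le> 1" and c: "c > 0"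
    and bounds: "\<And>r. 0 < r \<Longrightarrow> r \<le> 1 \<Longrightarrow> c * r powr (real CARD('n) - \<delta>) \<le> nbhd_vol S r"
  obtains c' where "c' > 0"
    "eventually (\<lambda>\<epsilon>. c' * \<epsilon> powr (real CARD('n) - \<delta>) * \<epsilon> powr (- (1 - \<alpha> * \<delta>) / (\<alpha> + 1))
       \<le> nbhd_vol (fractal_nest \<alpha> S) \<epsilon>) (at_right 0)"
proof -
  define p where "p = real CARD('n) - \<delta>"
  \<comment> \<open>Chosen so that \<open>2 * b powr (\<alpha> + 1) < \<alpha>\<close>: the gap at
    index \<open>l \<le> b * M\<close> is at least
    \<open>\<alpha> * l powr (- \<alpha> - 1)\<close>, and
    \<open>M powr (\<alpha> + 1) * \<epsilon> = 1\<close>, so it exceeds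
    \<open>2 * \<epsilon>\<close>. The minimum with 1 keeps \<open>b * M \<le> M\<close>.\<close>
  define b where "b = min 1 ((\<alpha> / 3) powr (1 / (\<alpha> + 1)))"
  have b: "0 < b" "b \<le> 1"
    using \<alpha> by (auto simp: b_def)
  have b\<alpha>: "2 * b powr (\<alpha> + 1) < \<alpha>"
  proof -
    have "b powr (\<alpha> + 1) \<le> ((\<alpha> / 3) powr (1 / (\<alpha> + 1))) powr (\<alpha> + 1)"
      using b \<alpha> by (intro powr_mono2) (auto simp: b_def)
    also have "\<dots> = \<alpha> / 3"
      using \<alpha> by (simp add: powr_powr)
    finally show ?thesis
      using \<alpha> by simp
  qed
  have bdd: "bounded (scaling t S)" for t
    using S bounded_subset bounded_sphere by (blast intro: bounded_scaling_set)
  define c' where "c' = c * (b / 2) powr (1 - \<alpha> * \<delta>)"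
  show thesis
  proof (rule that[of c'])
    show "c' > 0"
      using c b by (simp add: c'_def)
    have "c' * \<epsilon> powr p * \<epsilon> powr (- (1 - \<alpha> * \<delta>) / (\<alpha> + 1)) \<le> nbhd_vol (fractal_nest \<alpha> S) \<epsilon>"
      if \<epsilon>: "0 < \<epsilon>" "\<epsilon> < b powr (\<alpha> + 1)" for \<epsilon>
    proof -
      have "b powr (\<alpha> + 1) \<le> 1"
        using b \<alpha> by (intro powr_le1) auto
      with \<epsilon> have \<epsilon>1: "\<epsilon> \<le> 1"
        by simp
      define M where "M = \<epsilon> powr (- 1 / (\<alpha> + 1))"
      note M = fractal_nest_cutoff[OF \<alpha> \<epsilon>(1) \<epsilon>1, folded M_def]
      have M\<epsilon>: "M powr (\<alpha> + 1) * \<epsilon> = 1"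
      proof -
        have "- 1 / (\<alpha> + 1) * (\<alpha> + 1) = - 1"
          using \<alpha> by simp
        then have "M powr (\<alpha> + 1) = \<epsilon> powr - 1"
          by (simp only: M_def powr_powr)
        then show ?thesis
          using \<epsilon>(1) by (simp add: powr_minus)
      qed
      have bM: "b * M \<ge> 1"
      proof -
        have "\<epsilon> powr (1 / (\<alpha> + 1)) \<le> (b powr (\<alpha> + 1)) powr (1 / (\<alpha> + 1))"
          using \<epsilon> \<alpha> by (intro powr_mono2) auto
        also have "\<dots> = b"
          using \<alpha> b by (simp add: powr_powr)
        finally show ?thesis
          using \<epsilon> by (simp add: M_def powr_minus field_simps)
      qed
      \<comment> \<open>As \<open>b * M \<ge> 1\<close>, taking the floor loses at most a factor 2,
        which explains \<open>b / 2\<close> in \<open>c'\<close>.\<close>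
      define K where "K = nat \<lfloor>b * M\<rfloor>"
      have K: "real K \<le> b * M" "b * M / 2 \<le> real K" "K \<ge> 1"
      proof -
        have "1 \<le> \<lfloor>b * M\<rfloor>"
          using bM by (simp add: le_floor_iff)
        then show "real K \<le> b * M" "b * M / 2 \<le> real K" "K \<ge> 1"
          unfolding K_def by linarith+
      qed
      have "b * M \<le> M"
        using b M(1) by simp
      with K have KM: "real K \<le> M"
        by simp
      define N where "N k = nbhd (scaling (real k powr - \<alpha>) S) \<epsilon>" for k :: nat
      have disj: "disjnt (N k) (N l)" if kl: "1 \<le> k" "k < l" "l \<le> K" for k l
        unfolding disjnt_iff
      proof safe
        fix x assume x: "x \<in> N k" "x \<in> N l"
        have "\<bar>norm x - real k powr - \<alpha>\<bar> \<le> \<epsilon>" "\<bar>norm x - real l powr - \<alpha>\<bar> \<le> \<epsilon>"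
          using x kl unfolding N_def by (auto intro!: norm_nbhd_scaling[OF S])
        then have "real k powr - \<alpha> - real l powr - \<alpha> \<le> 2 * \<epsilon>"
          by linarith
        moreover have "real l powr - \<alpha> + \<alpha> * (real l - real k) * real l powr (- \<alpha> - 1) \<le> real k powr - \<alpha>"
          using kl \<alpha> by (intro powr_neg_gap) auto
        moreover have "\<alpha> * 1 * real l powr (- \<alpha> - 1) \<le> \<alpha> * (real l - real k) * real l powr (- \<alpha> - 1)"
          using kl \<alpha> by (intro mult_right_mono mult_left_mono) auto
        ultimately have "\<alpha> * real l powr (- (\<alpha> + 1)) \<le> 2 * \<epsilon>"
          by simp
        then have "\<alpha> \<le> 2 * \<epsilon> * real l powr (\<alpha> + 1)"
          using kl by (simp only: powr_minus) (simp add: field_simps)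
        also have "\<dots> \<le> 2 * \<epsilon> * (b * M) powr (\<alpha> + 1)"
          using kl K \<epsilon> \<alpha> by (intro mult_left_mono powr_mono2) auto
        also have "\<dots> = 2 * b powr (\<alpha> + 1) * (M powr (\<alpha> + 1) * \<epsilon>)"
          using b M(1) by (simp add: powr_mult)
        also have "\<dots> < \<alpha>"
          using b\<alpha> by (simp add: M\<epsilon>)
        finally show False
          by simp
      qed
      have pw: "pairwise (\<lambda>k l. disjnt (N k) (N l)) {1..K}"
        unfolding pairwise_def using disj disjnt_sym by (metis atLeastAtMost_iff linorder_neqE_nat)
      have meas: "N k \<in> lmeasurable" for k
        unfolding N_def by (intro lmeasurable_nbhd bdd)
      have "c' * \<epsilon> powr p * M powr (1 - \<alpha> * \<delta>) = c * \<epsilon> powr p * (b * M / 2) powr (1 - \<alpha> * \<delta>)"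
        using b M(1) by (simp add: c'_def powr_mult powr_divide)
      also have "\<dots> \<le> c * \<epsilon> powr p * real K powr (1 - \<alpha> * \<delta>)"
        using K bM c \<delta> by (intro mult_left_mono powr_mono2) auto
      \<comment> \<open>\<open>K\<close> copies of the smallest summand, the one at
        \<open>k = K\<close>, already give the right order.\<close>
      also have "\<dots> = (\<Sum>k=1..K. c * \<epsilon> powr p * real K powr - (\<alpha> * \<delta>))"
        using K(3) by (simp add: powr_diff powr_minus divide_inverse)
      also have "\<dots> \<le> (\<Sum>k=1..K. measure lebesgue (N k))"
      proof (rule sum_mono)
        fix k assume k: "k \<in> {1..K}"
        have "c * \<epsilon> powr p * real K powr - (\<alpha> * \<delta>) \<le> c * \<epsilon> powr p * real k powr - (\<alpha> * \<delta>)"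
          using k c \<alpha> \<delta> by (intro mult_left_mono powr_mono2') auto
        also have "\<dots> = c * \<epsilon> powr p * (real k powr - \<alpha>) powr \<delta>"
          by (simp add: powr_powr)
        also have "\<dots> \<le> nbhd_vol (scaling (real k powr - \<alpha>) S) \<epsilon>"
          unfolding p_def
        proof (rule nbhd_vol_scaling_ge[where R = 1])
          show "\<epsilon> \<le> 1 * real k powr - \<alpha>"
            using k KM M(3)[of "real k"] by simp
        qed (use k \<epsilon> bounds in auto)
        finally show "c * \<epsilon> powr p * real K powr - (\<alpha> * \<delta>) \<le> measure lebesgue (N k)"
          by (simp add: N_def nbhd_vol_def)
      qed
      also have "\<dots> = measure lebesgue (\<Union>k\<in>{1..K}. N k)"
        by (rule measure_UNION'[symmetric, OF _ _ pw]) (use meas in auto)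
      also have "\<dots> \<le> nbhd_vol (fractal_nest \<alpha> S) \<epsilon>"
        unfolding nbhd_vol_def
      proof (rule measure_mono_fmeasurable)
        show "(\<Union>k\<in>{1..K}. N k) \<subseteq> nbhd (fractal_nest \<alpha> S) \<epsilon>"
        proof (rule UN_least)
          fix k assume "k \<in> {1..K}"
          then show "N k \<subseteq> nbhd (fractal_nest \<alpha> S) \<epsilon>"
            unfolding N_def fractal_nest_def by (intro nbhd_mono) auto
        qed
        show "nbhd (fractal_nest \<alpha> S) \<epsilon> \<in> lmeasurable"
          using S \<alpha> by (intro lmeasurable_nbhd bounded_fractal_nest) auto
        show "(\<Union>k\<in>{1..K}. N k) \<in> sets lebesgue"
          using meas by (auto intro: fmeasurableD)
      qed
      finally show ?thesis
        by (simp only: M_def powr_powr times_divide_eq_left mult_minus1)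
    qed
    then show "eventually (\<lambda>\<epsilon>. c' * \<epsilon> powr (real CARD('n) - \<delta>) * \<epsilon> powr (- (1 - \<alpha> * \<delta>) / (\<alpha> + 1))
       \<le> nbhd_vol (fractal_nest \<alpha> S) \<epsilon>) (at_right 0)"
      unfolding eventually_at_right_field p_def using b by (intro exI[of _ "b powr (\<alpha> + 1)"]) auto
  qed
qed

section \<open>The three regimes of \<alpha>\<delta>\<close>

lemma sum_powr_neg_cutoff_le:
  fixes \<alpha> \<epsilon> s :: real
  assumes "0 \<le> s" "s < 1" "\<epsilon> > 0"
  shows "(\<Sum>k=1..nat \<lfloor>\<epsilon> powr (- 1 / (\<alpha> + 1))\<rfloor>. real k powr - s) \<le>
    \<epsilon> powr (- (1 - s) / (\<alpha> + 1)) / (1 - s)"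
proof -
  define M where "M = \<epsilon> powr (- 1 / (\<alpha> + 1))"
  have M: "M \<ge> 0"
    by (simp add: M_def)
  have "(\<Sum>k=1..nat \<lfloor>M\<rfloor>. real k powr - s) \<le> real (nat \<lfloor>M\<rfloor>) powr (1 - s) / (1 - s)"
    using assms by (intro sum_powr_neg_le)
  also have "\<dots> \<le> M powr (1 - s) / (1 - s)"
    using assms M by (intro divide_right_mono powr_mono2) auto
  also have "M powr (1 - s) = \<epsilon> powr (- (1 - s) / (\<alpha> + 1))"
    by (simp only: M_def powr_powr times_divide_eq_left mult_minus1)
  finally show ?thesis
    by (simp only: M_def)
qed

theorem theorem1:
  fixes S :: "(real ^ 'n) set" and \<delta> \<alpha> :: real
  assumes "S \<in> sets borel"
    and "S \<subseteq> sphere 0 1"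
    and "has_nondegenerate_box_dim S \<delta>"
    and "\<delta> \<ge> 0"
    and "\<alpha> > 0"
  shows "(\<alpha> * \<delta> < 1 \<longrightarrow>
            has_nondegenerate_box_dim (fractal_nest \<alpha> S) ((\<delta> + 1) / (\<alpha> + 1))) \<and>
         (\<alpha> * \<delta> = 1 \<longrightarrow> has_box_dim (fractal_nest \<alpha> S) \<delta>) \<and>
         (\<alpha> * \<delta> > 1 \<longrightarrow> has_nondegenerate_box_dim (fractal_nest \<alpha> S) \<delta>)"
proof -
  note S = assms(2) and \<delta> = assms(4) and \<alpha> = assms(5)
  define F where "F = fractal_nest \<alpha> S"
  define p where "p = real CARD('n) - \<delta>"
  define \<Sigma> where "\<Sigma> \<epsilon> = (\<Sum>k=1..nat \<lfloor>\<epsilon> powr (- 1 / (\<alpha> + 1))\<rfloor>. real k powr - (\<alpha> * \<delta>))" for \<epsilon> :: real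
  define E where "E \<epsilon> = \<epsilon> powr (- (1 - \<alpha> * \<delta>) / (\<alpha> + 1))" for \<epsilon> :: real
  have bdd: "bounded S" "bounded F"
    using S \<alpha> bounded_subset[OF bounded_sphere] bounded_fractal_nest[of S \<alpha>] by (auto simp: F_def)
  obtain c0 C0 where 0: "c0 > 0"
    "eventually (\<lambda>\<epsilon>. c0 * \<epsilon> powr (real CARD('n) - \<delta>) \<le> nbhd_vol S \<epsilon>) (at_right 0)"
    "eventually (\<lambda>\<epsilon>. nbhd_vol S \<epsilon> \<le> C0 * \<epsilon> powr (real CARD('n) - \<delta>)) (at_right 0)"
    using has_nondegenerate_box_dimD[OF assms(3)] .
  obtain c C where c: "c > 0" and C: "C > 0"
    and lowerS: "\<And>r. 0 < r \<Longrightarrow> r \<le> 3 \<Longrightarrow> c * r powr (real CARD('n) - \<delta>) \<le> nbhd_vol S r"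
    and upperS: "\<And>r. 0 < r \<Longrightarrow> r \<le> 3 \<Longrightarrow> nbhd_vol S r \<le> C * r powr (real CARD('n) - \<delta>)"
    using nbhd_vol_bounds_extend[OF bdd(1) 0, of 3] by auto
  obtain U where U: "U > 0"
    and upperF: "\<And>\<epsilon>. 0 < \<epsilon> \<Longrightarrow> \<epsilon> \<le> 1 \<Longrightarrow> nbhd_vol F \<epsilon> \<le> U * \<epsilon> powr p * (\<Sigma> \<epsilon> + E \<epsilon>)"
    using nbhd_vol_fractal_nest_le[OF S \<alpha> \<delta> C upperS] unfolding F_def p_def \<Sigma>_def E_def by blast
  have small: "eventually P (at_right 0)" if "\<And>\<epsilon>. 0 < \<epsilon> \<Longrightarrow> \<epsilon> \<le> 1 \<Longrightarrow> P \<epsilon>" for P :: "real \<Rightarrow> bool"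
    unfolding eventually_at_right_field using that by (intro exI[of _ 1]) auto
  \<comment> \<open>The layer \<open>k = 1\<close> is \<open>S\<close> itself.\<close>
  have lowerF: "eventually (\<lambda>\<epsilon>. c * \<epsilon> powr p \<le> nbhd_vol F \<epsilon>) (at_right 0)"
  proof (rule small)
    fix \<epsilon> :: real assume "0 < \<epsilon>" "\<epsilon> \<le> 1"
    then show "c * \<epsilon> powr p \<le> nbhd_vol F \<epsilon>"
      using lowerS[of \<epsilon>] nbhd_vol_mono[OF bdd(2), of S \<epsilon> \<epsilon>] fractal_nest_superset[of S \<alpha>]
      by (simp add: p_def F_def)
  qed
  have "has_nondegenerate_box_dim F ((\<delta> + 1) / (\<alpha> + 1))" if s: "\<alpha> * \<delta> < 1"
  proof -
    have exponent: "\<epsilon> powr (real CARD('n) - (\<delta> + 1) / (\<alpha> + 1)) = \<epsilon> powr p * E \<epsilon>" for \<epsilon>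
    proof -
      have "real CARD('n) - (\<delta> + 1) / (\<alpha> + 1) = p + - (1 - \<alpha> * \<delta>) / (\<alpha> + 1)"
        using \<alpha> by (simp add: p_def field_simps)
      then show ?thesis
        by (simp only: powr_add E_def)
    qed
    have lowerS1: "c * r powr (real CARD('n) - \<delta>) \<le> nbhd_vol S r" if "0 < r" "r \<le> 1" for r
      using that lowerS[of r] by simp
    obtain c' where c': "c' > 0"
      "eventually (\<lambda>\<epsilon>. c' * \<epsilon> powr p * E \<epsilon> \<le> nbhd_vol F \<epsilon>) (at_right 0)"
      using nbhd_vol_fractal_nest_ge[OF S \<alpha> \<delta> less_imp_le[OF s] c lowerS1]
      unfolding F_def p_def E_def by blast
    show ?thesis
    proof (rule has_nondegenerate_box_dimI[OF bdd(2) c'(1)])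
      show "eventually (\<lambda>\<epsilon>. c' * \<epsilon> powr (real CARD('n) - (\<delta> + 1) / (\<alpha> + 1)) \<le> nbhd_vol F \<epsilon>) (at_right 0)"
        using c'(2) by (simp only: exponent mult.assoc)
      show "eventually (\<lambda>\<epsilon>. nbhd_vol F \<epsilon> \<le>
          U * (1 / (1 - \<alpha> * \<delta>) + 1) * \<epsilon> powr (real CARD('n) - (\<delta> + 1) / (\<alpha> + 1))) (at_right 0)"
      proof (rule small)
        fix \<epsilon> :: real assume \<epsilon>: "0 < \<epsilon>" "\<epsilon> \<le> 1"
        have "\<Sigma> \<epsilon> \<le> E \<epsilon> / (1 - \<alpha> * \<delta>)"
          unfolding \<Sigma>_def E_def using s \<epsilon> \<alpha> \<delta> by (intro sum_powr_neg_cutoff_le) auto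
        then have "U * \<epsilon> powr p * (\<Sigma> \<epsilon> + E \<epsilon>) \<le> U * \<epsilon> powr p * ((1 / (1 - \<alpha> * \<delta>) + 1) * E \<epsilon>)"
          using U by (intro mult_left_mono) (auto simp: distrib_right)
        then show "nbhd_vol F \<epsilon> \<le>
            U * (1 / (1 - \<alpha> * \<delta>) + 1) * \<epsilon> powr (real CARD('n) - (\<delta> + 1) / (\<alpha> + 1))"
          using upperF[OF \<epsilon>] by (simp only: exponent mult_ac)
      qed
    qed
  qed
  moreover have "has_box_dim F \<delta>" if s: "\<alpha> * \<delta> = 1"
  proof (rule has_box_dimI[OF bdd(2) c lowerF[unfolded p_def]])
    fix \<eta> :: real assume \<eta>: "\<eta> > 0"
    \<comment> \<open>Replacing \<open>k powr - 1\<close> by the larger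
      \<open>k powr - (1 - \<theta>)\<close> turns the harmonic sum into one bounded by a multiple
      of \<open>\<epsilon> powr (- \<theta> / (\<alpha> + 1))\<close>, within the permitted loss
      \<eta>. The cap 1/2 keeps \<open>1 - \<theta>\<close> in the range of the sum
      estimate.\<close>
    define \<theta> where "\<theta> = min (1 / 2) \<eta>"
    have \<theta>: "0 < \<theta>" "\<theta> < 1" "\<theta> \<le> \<eta>"
      using \<eta> by (auto simp: \<theta>_def)
    have "nbhd_vol F \<epsilon> \<le> U * (1 / \<theta> + 1) * \<epsilon> powr (real CARD('n) - \<delta> - \<eta>)" if \<epsilon>: "0 < \<epsilon>" "\<epsilon> \<le> 1" for \<epsilon>
    proof -
      have "\<Sigma> \<epsilon> \<le> (\<Sum>k=1..nat \<lfloor>\<epsilon> powr (- 1 / (\<alpha> + 1))\<rfloor>. real k powr - (1 - \<theta>))"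
        unfolding \<Sigma>_def s using \<theta> by (intro sum_mono powr_mono) auto
      also have "\<dots> \<le> \<epsilon> powr (- (1 - (1 - \<theta>)) / (\<alpha> + 1)) / (1 - (1 - \<theta>))"
        using \<theta> \<epsilon> by (intro sum_powr_neg_cutoff_le) auto
      also have "\<dots> \<le> \<epsilon> powr (- \<eta>) / \<theta>"
      proof -
        have "\<theta> \<le> \<eta> * (\<alpha> + 1)"
          using \<theta> \<alpha> \<eta> mult_mono[of \<theta> \<eta> 1 "\<alpha> + 1"] by simp
        then have "- \<eta> \<le> - (1 - (1 - \<theta>)) / (\<alpha> + 1)"
          using \<alpha> by (simp add: pos_divide_le_eq)
        then show ?thesis
          using \<epsilon> \<theta> by (simp only: diff_diff_eq2 add_diff_cancel_left') (auto intro!: divide_right_mono powr_mono')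
      qed
      finally have "\<Sigma> \<epsilon> \<le> \<epsilon> powr (- \<eta>) / \<theta>" .
      moreover have "E \<epsilon> \<le> \<epsilon> powr (- \<eta>)"
        using powr_mono'[of "- \<eta>" 0 \<epsilon>] \<epsilon> \<eta> by (simp add: E_def s)
      ultimately have "U * \<epsilon> powr p * (\<Sigma> \<epsilon> + E \<epsilon>) \<le> U * \<epsilon> powr p * ((1 / \<theta> + 1) * \<epsilon> powr (- \<eta>))"
        using U by (intro mult_left_mono) (auto simp: distrib_right)
      also have "\<dots> = U * (1 / \<theta> + 1) * \<epsilon> powr (p + - \<eta>)"
        by (simp only: powr_add mult_ac)
      finally show ?thesis
        using upperF[OF \<epsilon>] by (simp add: p_def)
    qed
    then show "\<exists>C. eventually (\<lambda>\<epsilon>. nbhd_vol F \<epsilon> \<le> C * \<epsilon> powr (real CARD('n) - \<delta> - \<eta>)) (at_right 0)"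
      by (intro exI small)
  qed
  moreover have "has_nondegenerate_box_dim F \<delta>" if s: "\<alpha> * \<delta> > 1"
  proof (rule has_nondegenerate_box_dimI[OF bdd(2) c lowerF[unfolded p_def]])
    \<comment> \<open>The series converges because \<alpha>\<delta> > 1; its term at
      \<open>k = 0\<close> vanishes since \<open>0 powr x = 0\<close>.\<close>
    define Z where "Z = (\<Sum>k. real k powr - (\<alpha> * \<delta>))"
    show "eventually (\<lambda>\<epsilon>. nbhd_vol F \<epsilon> \<le> U * (Z + 1) * \<epsilon> powr (real CARD('n) - \<delta>)) (at_right 0)"
    proof (rule small)
      fix \<epsilon> :: real assume \<epsilon>: "0 < \<epsilon>" "\<epsilon> \<le> 1"
      have "\<Sigma> \<epsilon> \<le> Z"
        unfolding \<Sigma>_def Z_def using s by (intro sum_le_suminf) (auto simp: summable_real_powr_iff)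
      moreover have "E \<epsilon> \<le> 1"
        unfolding E_def using s \<epsilon> \<alpha> by (intro powr_le1) auto
      ultimately have "U * \<epsilon> powr p * (\<Sigma> \<epsilon> + E \<epsilon>) \<le> U * \<epsilon> powr p * (Z + 1)"
        using U by (intro mult_left_mono) auto
      then show "nbhd_vol F \<epsilon> \<le> U * (Z + 1) * \<epsilon> powr (real CARD('n) - \<delta>)"
        using upperF[OF \<epsilon>] by (simp add: p_def mult_ac)
    qed
  qed
  ultimately show ?thesis
    by (simp add: F_def)
qed

end
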